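(* Let $q=2^st+1$ be an odd prime power with $s\ge 1$ and $t$ odd, let $d$ be a positive odd integer with $q\equiv 1\pmod{2d}$, and let $\gamma$ be a primitive $d$th root of unity in $\mathbb{F}_q^*$. Then for any integer $n\ge 1$ the following factorization holds over $\mathbb{F}_q$. If $n\le s$, then $$x^{2^nd}-1=\prod_{j=0}^{d-1}\Bigl((x-\gamma^j)\prod_{\substack{1\le k\le n\\ 1\le i\le 2^{k-1}}}(x-\alpha_{2^k}^{2i-1}\gamma^j)\Bigr),$$ and if $n>s$, then $$x^{2^nd}-1=\prod_{j=0}^{d-1}\Bigl((x-\gamma^j)\prod_{\substack{1\le k\le s\\ 1\le i\le 2^{k-1}}}(x-\alpha_{2^k}^{2i-1}\gamma^j)\prod_{\substack{1\le r\le n-s\\ 1\le i\le 2^{s-1}}}(x^{2^r}-\alpha_{2^s}^{2i-1}\gamma^j)\Bigr).$$ Further, if $n>s\ge 2$, this factorization of $x^{2^nd}-1$ over $\mathbb{F}_q$ has $2^{s-1}(n-s+2)d$ irreducible factors; however, if $q\equiv 3\pmod 4$, all nonlinear factors in the factorization are reducible over $\mathbb{F}_q$ except the binomials $x^2+\gamma^j$ for $0\le j\le d-1$.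
   Context: $\mathbb{F}_q$ is the finite field with $q$ elements. For $0\le k\le s$, $\alpha_{2^k}$ denotes a primitive $2^k$th root of unity in $\mathbb{F}_q^*$. *)

theory Defs
  imports
    "HOL-Computational_Algebra.Computational_Algebra"
    "HOL-Number_Theory.Cong"
    "HOL-Number_Theory.Prime_Powers"
begin

definition primitive_root_of_unity :: "nat \<Rightarrow> 'a::field \<Rightarrow> bool" where
  "primitive_root_of_unity m x \<longleftrightarrow>
     0 < m \<and> x ^ m = 1 \<and> (\<forall>k. 0 < k \<and> k < m \<longrightarrow> x ^ k \<noteq> 1)"

(* The factors of x^(2^n * d) - 1 in the case n > s, listed with repetitions, so that "the number
   of factors" does not presuppose that they are distinct. The argument \<alpha> is indexed
   by the order: \<alpha> (2^k) is the chosen primitive 2^k-th root of unity. [:a, 1:] is x + a. *)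
definition binomial_factors ::
    "nat \<Rightarrow> nat \<Rightarrow> nat \<Rightarrow> (nat \<Rightarrow> 'a::field) \<Rightarrow> 'a \<Rightarrow> 'a poly multiset" where
  "binomial_factors s d n \<alpha> \<gamma> =
     (\<Sum>j=0..d-1.
        {# [:- (\<gamma> ^ j), 1:] #}
        + (\<Sum>k=1..s. \<Sum>i=1..2^(k-1). {# [:- (\<alpha> (2^k) ^ (2*i-1) * \<gamma> ^ j), 1:] #})
        + (\<Sum>r=1..n-s. \<Sum>i=1..2^(s-1).
             {# monom 1 (2^r) - [:\<alpha> (2^s) ^ (2*i-1) * \<gamma> ^ j:] #}))"

lemma prod_mset_sum_image:
  "prod_mset (\<Sum>x\<in>A. f x) = (\<Prod>x\<in>A. prod_mset (f x))"
  for f :: "'b \<Rightarrow> 'c::comm_monoid_mult multiset"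
  by (induction A rule: infinite_finite_induct) auto

lemma prod_mset_binomial_factors:
  "prod_mset (binomial_factors s d n \<alpha> \<gamma>) =
     (\<Prod>j=0..d-1.
        [:- (\<gamma> ^ j), 1:]
        * (\<Prod>k=1..s. \<Prod>i=1..2^(k-1). [:- (\<alpha> (2^k) ^ (2*i-1) * \<gamma> ^ j), 1:])
        * (\<Prod>r=1..n-s. \<Prod>i=1..2^(s-1).
             (monom 1 (2^r) - [:\<alpha> (2^s) ^ (2*i-1) * \<gamma> ^ j:])))"
  by (simp add: binomial_factors_def prod_mset_sum_image mult.assoc
      del: mult_pCons_left mult_pCons_right)

end

theory Submission
  imports Defs
begin

text \<open>
  The three claims rest on three separate ideas.

  Factorization. Write \<open>z = x ^ d\<close>. The polynomial \<open>x ^ (2 ^ n * d) - 1\<close> telescopes as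
  \<open>(z - 1) * (\<Prod>k=1..n. z ^ 2 ^ (k - 1) + 1)\<close>. A primitive \<open>2 ^ k\<close>-th root of unity \<open>a\<close>
  has as its odd powers exactly the roots of \<open>Y ^ 2 ^ (k - 1) = -1\<close>. As \<open>d\<close> is odd, multiplying
  these by the powers of \<open>\<gamma>\<close> splits \<open>Y ^ (2 ^ (k - 1) * d) + 1\<close> into linear factors in \<open>Y\<close>
  (\<open>prod_odd_powers_roots_of_unity\<close>). For \<open>k \<le> s\<close> this is used with \<open>Y = x\<close>. The field has
  no roots of unity of order \<open>2 ^ (s + r)\<close> for \<open>r \<ge> 1\<close>; instead, \<open>Y = x ^ 2 ^ r\<close> with \<open>k = s\<close>
  gives the level \<open>s + r\<close>. Both cases of the factorization are instances of the same
  computation. It is essential to take the product over all \<open>j\<close>: for a fixed \<open>j\<close> the constants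
  of consecutive levels do not match.

  Irreducibility. Put \<open>\<beta> = a ^ (2 * i - 1) * \<gamma> ^ j\<close> with \<open>a\<close> of order \<open>2 ^ s\<close>. Since \<open>d\<close>
  divides \<open>t\<close>, \<open>\<beta> ^ (2 ^ (s - 1) * t) = -1\<close>, that is, \<open>\<beta>\<close> is not a square. Let \<open>f\<close> be an
  irreducible factor of \<open>x ^ 2 ^ r - \<beta>\<close> of degree \<open>m\<close>. Fermat's theorem modulo \<open>f\<close> gives
  \<open>x ^ (q ^ m - 1) = 1\<close>. If \<open>m\<close> were less than \<open>2 ^ r\<close>, too few factors \<open>2\<close> would
  divide \<open>q ^ m - 1\<close> (\<open>power_minus_1_two_part\<close>): some power of this congruence reads
  \<open>\<beta> ^ (2 ^ (s - 1) * w) = 1\<close> with \<open>w\<close> odd, which contradicts the value \<open>-1\<close> above. Hence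
  \<open>f\<close> has full degree (\<open>irreducible_binomial_power_2\<close>). The count of powers of \<open>2\<close>
  needs \<open>q\<close> to be \<open>1\<close> modulo \<open>4\<close>, unless \<open>r \<le> 1\<close>; the factors are
  pairwise different because \<open>x ^ N - 1\<close> is squarefree when \<open>N\<close> is coprime to \<open>q\<close>.

  Reducibility when \<open>q\<close> is \<open>3\<close> modulo \<open>4\<close>. Then \<open>s = 1\<close> and the nonlinear factors are
  \<open>x ^ 2 ^ r + \<gamma> ^ j\<close>. Here \<open>\<gamma> ^ j / 4\<close> has odd order, so it is a fourth power \<open>b ^ 4\<close>,
  and for \<open>r \<ge> 2\<close> the Sophie Germain identity factors \<open>y ^ 4 + 4 * b ^ 4\<close>.
\<close>

section \<open>Primitive roots of unity\<close>

lemma primitive_root_power_eq_1_iff: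
  fixes z :: "'a::field"
  assumes "primitive_root_of_unity m z"
  shows "z ^ k = 1 \<longleftrightarrow> m dvd k"
proof
  have m: "0 < m" "z ^ m = 1" "\<And>k. 0 < k \<Longrightarrow> k < m \<Longrightarrow> z ^ k \<noteq> 1"
    using assms by (auto simp: primitive_root_of_unity_def)
  show "m dvd k" if "z ^ k = 1"
  proof -
    have "z ^ k = (z ^ m) ^ (k div m) * z ^ (k mod m)"
      by (simp flip: power_mult power_add)
    hence "z ^ (k mod m) = 1"
      using that m by simp
    with m(1) m(3)[of "k mod m"] have "k mod m = 0"
      by (metis gr0I mod_less_divisor)
    thus ?thesis by auto
  qed
  show "z ^ k = 1" if "m dvd k"
    using that m(2) by (auto simp: power_mult)
qed

lemma primitive_rootI:
  fixes z :: "'a::field"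
  assumes "0 < m" "\<And>k. z ^ k = 1 \<longleftrightarrow> m dvd k"
  shows "primitive_root_of_unity m z"
  unfolding primitive_root_of_unity_def using assms by (auto dest: nat_dvd_not_less)

lemma primitive_root_power_coprime:
  fixes z :: "'a::field"
  assumes "primitive_root_of_unity m z" "coprime m e"
  shows "primitive_root_of_unity m (z ^ e)"
proof (rule primitive_rootI)
  show "0 < m" using assms by (simp add: primitive_root_of_unity_def)
  show "(z ^ e) ^ k = 1 \<longleftrightarrow> m dvd k" for k
    using primitive_root_power_eq_1_iff[OF assms(1), of "e * k"] assms(2)
    by (simp add: power_mult coprime_dvd_mult_right_iff)
qed

lemma primitive_root_square:
  fixes z :: "'a::field"
  assumes "primitive_root_of_unity (2 * m) z"
  shows "primitive_root_of_unity m (z\<^sup>2)"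
proof (rule primitive_rootI)
  show "0 < m" using assms by (simp add: primitive_root_of_unity_def)
  show "(z\<^sup>2) ^ k = 1 \<longleftrightarrow> m dvd k" for k
    using primitive_root_power_eq_1_iff[OF assms, of "2 * k"]
    by (simp add: power_mult)
qed

lemma primitive_root_half_power:
  fixes z :: "'a::field"
  assumes "primitive_root_of_unity (2 * m) z"
  shows "z ^ m = -1"
proof -
  have "(z ^ m)\<^sup>2 = 1" "z ^ m \<noteq> 1"
    using assms by (auto simp: primitive_root_of_unity_def simp flip: power_mult)
       (simp_all add: mult.commute)
  thus ?thesis by (simp add: power2_eq_1_iff)
qed

lemma primitive_root_powers_inj:
  fixes z :: "'a::field"
  assumes "primitive_root_of_unity m z"
  shows "inj_on (\<lambda>i. z ^ i) {..<m}"
proof (rule linorder_inj_onI')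
  fix i j assume ij: "i \<in> {..<m}" "j \<in> {..<m}" "i < j"
  have "z \<noteq> 0" using assms by (auto simp: primitive_root_of_unity_def power_0_left)
  moreover have "z ^ (j - i) \<noteq> 1"
    using assms ij by (auto simp: primitive_root_of_unity_def)
  moreover have "z ^ j = z ^ i * z ^ (j - i)"
    using ij by (simp flip: power_add)
  ultimately show "z ^ i \<noteq> z ^ j" by auto
qed

section \<open>Splitting powers of two times an odd number\<close>

lemma prod_linear_scaled_roots_of_unity:
  fixes z c :: "'a::field"
  assumes z: "primitive_root_of_unity m z" and "c \<noteq> 0"
  shows "(\<Prod>i<m. [:- (c * z ^ i), 1:]) = monom 1 m - [:c ^ m:]"
proof (rule poly_eqI_degree_lead_coeff[where n = m and A = "(\<lambda>i. c * z ^ i) ` {..<m}"])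
  have m: "0 < m" "z ^ m = 1" using z by (auto simp: primitive_root_of_unity_def)
  have "inj_on (\<lambda>i. c * z ^ i) {..<m}"
    using primitive_root_powers_inj[OF z] \<open>c \<noteq> 0\<close> by (auto simp: inj_on_def)
  thus "m \<le> card ((\<lambda>i. c * z ^ i) ` {..<m})" by (simp add: card_image)
  have deg: "degree (\<Prod>i<m. [:- (c * z ^ i), 1:]) = m"
    by (subst degree_prod_eq_sum_degree) auto
  thus "degree (\<Prod>i<m. [:- (c * z ^ i), 1:]) \<le> m" by simp
  have "lead_coeff (\<Prod>i<m. [:- (c * z ^ i), 1:]) = 1"
    by (simp add: lead_coeff_prod)
  thus "coeff (\<Prod>i<m. [:- (c * z ^ i), 1:]) m = coeff (monom 1 m - [:c ^ m:]) m"
    using m deg by (simp add: coeff_pCons split: nat.splits)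
  show "degree (monom 1 m - [:c ^ m:]) \<le> m"
    by (intro degree_diff_le) (auto simp: degree_monom_eq)
  fix x assume "x \<in> (\<lambda>i. c * z ^ i) ` {..<m}"
  then obtain i where i: "i < m" "x = c * z ^ i" by auto
  have "x ^ m = c ^ m * (z ^ m) ^ i"
    by (simp add: i power_mult_distrib mult.commute flip: power_mult)
  thus "poly (\<Prod>i<m. [:- (c * z ^ i), 1:]) x = poly (monom 1 m - [:c ^ m:]) x"
    using i m by (auto simp: poly_prod poly_monom)
qed

text \<open>
  Substituting an arbitrary polynomial for the variable lets the same identity serve for the linear
  factors as well as for the binomials in \<open>x ^ 2 ^ r\<close>.
\<close>
lemma prod_diff_scaled_roots_of_unity:
  fixes z c :: "'a::field"
  assumes "primitive_root_of_unity m z" "c \<noteq> 0"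
  shows "(\<Prod>i<m. Y - [:c * z ^ i:]) = Y ^ m - [:c ^ m:]"
proof -
  have "(\<Prod>i<m. Y - [:c * z ^ i:]) = (\<Prod>i<m. [:- (c * z ^ i), 1:]) \<circ>\<^sub>p Y"
    unfolding pcompose_prod by (intro prod.cong) (auto simp: pcompose_pCons)
  also have "\<dots> = monom 1 m \<circ>\<^sub>p Y - [:c ^ m:]"
    using assms by (simp add: prod_linear_scaled_roots_of_unity pcompose_diff)
  also have "monom 1 m \<circ>\<^sub>p Y = Y ^ m"
    by (induction m) (simp_all add: monom_0 monom_Suc pcompose_pCons)
  finally show ?thesis .
qed

text \<open>
  The odd powers of \<open>a\<close> are \<open>a\<close> times the powers of \<open>a\<^sup>2\<close>, a primitive \<open>m\<close>-th root of unity,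
  and \<open>a ^ m = -1\<close>.
\<close>
lemma prod_odd_powers:
  fixes a c :: "'a::field"
  assumes a: "primitive_root_of_unity (2 * m) a" and "c \<noteq> 0"
  shows "(\<Prod>i=1..m. Y - [:a ^ (2 * i - 1) * c:]) = Y ^ m + [:c ^ m:]"
proof -
  have "a \<noteq> 0" using a by (auto simp: primitive_root_of_unity_def power_0_left)
  have "(\<Prod>i=1..m. Y - [:a ^ (2 * i - 1) * c:]) = (\<Prod>i<m. Y - [:(a * c) * (a\<^sup>2) ^ i:])"
    by (rule prod.reindex_bij_witness[of _ Suc "\<lambda>i. i - 1"])
       (auto simp: power_mult[symmetric] Suc_diff_Suc algebra_simps
             simp flip: power_Suc)
  also have "\<dots> = Y ^ m - [:(a * c) ^ m:]"
    by (rule prod_diff_scaled_roots_of_unity) (use \<open>a \<noteq> 0\<close> assms primitive_root_square in auto)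
  also have "\<dots> = Y ^ m + [:c ^ m:]"
    by (simp add: power_mult_distrib primitive_root_half_power[OF a])
  finally show ?thesis .
qed

text \<open>
  The product over \<open>i\<close> is \<open>Y ^ m + (g ^ m) ^ j\<close>. Since \<open>d\<close> and \<open>m\<close> are coprime, \<open>g ^ m\<close> is
  again a primitive \<open>d\<close>-th root of unity, so \<open>j\<close> merely runs through all of its powers;
  the sign survives because \<open>d\<close> is odd.
\<close>
lemma prod_odd_powers_roots_of_unity:
  fixes a g :: "'a::field"
  assumes a: "primitive_root_of_unity (2 * m) a" and g: "primitive_root_of_unity d g"
    and "odd d" "coprime d m"
  shows "(\<Prod>j<d. \<Prod>i=1..m. Y - [:a ^ (2 * i - 1) * g ^ j:]) = Y ^ (m * d) + 1"
proof -
  have "g \<noteq> 0" using g by (auto simp: primitive_root_of_unity_def power_0_left)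
  have "(\<Prod>j<d. \<Prod>i=1..m. Y - [:a ^ (2 * i - 1) * g ^ j:]) = (\<Prod>j<d. Y ^ m + [:(g ^ j) ^ m:])"
    using a \<open>g \<noteq> 0\<close> by (intro prod.cong prod_odd_powers) auto
  also have "\<dots> = (\<Prod>j<d. Y ^ m - [:(-1) * (g ^ m) ^ j:])"
    by (intro prod.cong) (auto simp: mult.commute simp flip: power_mult)
  also have "\<dots> = (Y ^ m) ^ d - [:(-1) ^ d:]"
    using assms by (intro prod_diff_scaled_roots_of_unity primitive_root_power_coprime) auto
  also have "[:(-1) ^ d:] = (-1 :: 'a poly)"
    using \<open>odd d\<close> by (simp add: one_pCons)
  finally show ?thesis
    by (simp add: power_mult)
qed

lemma prod_plus_1_telescope:
  fixes z :: "'a::comm_ring_1"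
  shows "(z - 1) * (\<Prod>k=1..n. z ^ 2 ^ (k - 1) + 1) = z ^ 2 ^ n - 1"
proof (induction n)
  case (Suc n)
  have "(z - 1) * (\<Prod>k=1..Suc n. z ^ 2 ^ (k - 1) + 1) = (z ^ 2 ^ n - 1) * (z ^ 2 ^ n + 1)"
    by (simp flip: Suc.IH add: mult_ac)
  also have "\<dots> = z ^ 2 ^ Suc n - 1"
    by (simp add: algebra_simps mult_2 power_add)
  finally show ?case .
qed simp

text \<open>
  The factors of level \<open>k\<close> multiply to \<open>z ^ 2 ^ (k - 1) + 1\<close> with \<open>z = x ^ d\<close>, and those that
  belong to \<open>r\<close> multiply to the factor of level \<open>s + r\<close>; the levels then telescope.
\<close>
lemma power_minus_1_factorization:
  fixes \<gamma> :: "'a::field" and \<alpha> :: "nat \<Rightarrow> 'a"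
  assumes g: "primitive_root_of_unity d \<gamma>" and "odd d"
    and a: "\<And>k. k \<le> s \<Longrightarrow> primitive_root_of_unity (2 ^ k) (\<alpha> (2 ^ k))"
  shows "(\<Prod>j<d. [:- (\<gamma> ^ j), 1:]
           * (\<Prod>k=1..s. \<Prod>i=1..2^(k-1). [:- (\<alpha> (2^k) ^ (2*i-1) * \<gamma> ^ j), 1:]))
         = monom 1 (2 ^ s * d) - 1"
    and "s \<ge> 1 \<Longrightarrow> s \<le> n \<Longrightarrow> (\<Prod>j<d. [:- (\<gamma> ^ j), 1:]
           * (\<Prod>k=1..s. \<Prod>i=1..2^(k-1). [:- (\<alpha> (2^k) ^ (2*i-1) * \<gamma> ^ j), 1:])
           * (\<Prod>r=1..n-s. \<Prod>i=1..2^(s-1).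
                (monom 1 (2^r) - [:\<alpha> (2^s) ^ (2*i-1) * \<gamma> ^ j:])))
         = monom 1 (2 ^ n * d) - 1"
proof -
  define X where "X = (monom 1 1 :: 'a poly)"
  define z where "z = X ^ d"
  have lin: "[:- c, 1:] = X - [:c:]" for c :: 'a
    by (simp add: X_def monom_altdef)
  have mon: "monom 1 k = X ^ k" for k
    by (simp add: X_def monom_altdef)
  have lev: "(\<Prod>j<d. \<Prod>i=1..2^(k-1). Y - [:\<alpha> (2^k) ^ (2*i-1) * \<gamma> ^ j:]) = (Y ^ 2 ^ (k - 1)) ^ d + 1"
    if "1 \<le> k" "k \<le> s" for k and Y :: "'a poly"
  proof (subst prod_odd_powers_roots_of_unity)
    have "2 * 2 ^ (k - 1) = (2 ^ k :: nat)" using that by (cases k) auto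
    thus "primitive_root_of_unity (2 * 2 ^ (k - 1)) (\<alpha> (2 ^ k))"
      using a[of k] that by simp
  qed (use g \<open>odd d\<close> in \<open>auto simp: power_mult\<close>)
  have A: "(\<Prod>j<d. X - [:\<gamma> ^ j:]) = z - 1"
    using prod_diff_scaled_roots_of_unity[OF g, of 1 X] by (simp add: one_pCons z_def)
  have B: "(\<Prod>j<d. \<Prod>k=1..s. \<Prod>i=1..2^(k-1). X - [:\<alpha> (2^k) ^ (2*i-1) * \<gamma> ^ j:])
     = (\<Prod>k=1..s. z ^ 2 ^ (k - 1) + 1)"
    by (subst prod.swap, intro prod.cong refl, subst lev)
       (auto simp: z_def mult.commute simp flip: power_mult)
  have AB: "(z - 1) * (\<Prod>k=1..s. z ^ 2 ^ (k - 1) + 1) = z ^ 2 ^ s - 1"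
    by (rule prod_plus_1_telescope)
  show "(\<Prod>j<d. [:- (\<gamma> ^ j), 1:]
           * (\<Prod>k=1..s. \<Prod>i=1..2^(k-1). [:- (\<alpha> (2^k) ^ (2*i-1) * \<gamma> ^ j), 1:]))
         = monom 1 (2 ^ s * d) - 1"
    unfolding lin prod.distrib A B AB mon
    by (simp add: z_def mult.commute flip: power_mult)
  assume s: "s \<ge> 1" "s \<le> n"
  have C: "(\<Prod>j<d. \<Prod>r=1..n-s. \<Prod>i=1..2^(s-1). monom 1 (2^r) - [:\<alpha> (2^s) ^ (2*i-1) * \<gamma> ^ j:])
     = (\<Prod>r=1..n-s. (z ^ 2 ^ s) ^ 2 ^ (r - 1) + 1)"
  proof (subst prod.swap, intro prod.cong refl, subst lev)
    fix r assume r: "r \<in> {1..n-s}"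
    have "2 ^ r * 2 ^ (s - 1) = (2 ^ s * 2 ^ (r - 1) :: nat)"
      using r s by (cases r; cases s) auto
    hence "2 ^ r * 2 ^ (s - 1) * d = d * 2 ^ s * 2 ^ (r - 1)" by simp
    thus "(monom 1 (2 ^ r) ^ 2 ^ (s - 1)) ^ d + 1 = (z ^ 2 ^ s) ^ 2 ^ (r - 1) + 1"
      unfolding mon z_def power_mult[symmetric] by (simp only:)
  qed (use s in auto)
  show "(\<Prod>j<d. [:- (\<gamma> ^ j), 1:]
           * (\<Prod>k=1..s. \<Prod>i=1..2^(k-1). [:- (\<alpha> (2^k) ^ (2*i-1) * \<gamma> ^ j), 1:])
           * (\<Prod>r=1..n-s. \<Prod>i=1..2^(s-1).
                (monom 1 (2^r) - [:\<alpha> (2^s) ^ (2*i-1) * \<gamma> ^ j:])))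
         = monom 1 (2 ^ n * d) - 1"
    unfolding prod.distrib C unfolding lin A B AB prod_plus_1_telescope
    using s by (simp add: z_def mon mult.commute mult.assoc flip: power_mult power_add)
qed

section \<open>Fermat's theorem modulo an irreducible polynomial\<close>

lemma card_polys_degree_less:
  "finite {p :: 'a::{field,finite} poly. p = 0 \<or> degree p < m} \<and>
   card {p :: 'a poly. p = 0 \<or> degree p < m} = card (UNIV :: 'a set) ^ m"
proof (induction m)
  case 0
  show ?case by simp
next
  case (Suc m)
  have eq: "{p :: 'a poly. p = 0 \<or> degree p < Suc m} =
     (\<lambda>(a, p). pCons a p) ` (UNIV \<times> {p. p = 0 \<or> degree p < m})" (is "?L = ?R")
  proof (intro equalityI subsetI)
    fix p :: "'a poly" assume "p \<in> ?L"
    obtain a r where "p = pCons a r" by (cases p)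
    with \<open>p \<in> ?L\<close> have "r = 0 \<or> degree r < m"
      by (auto split: if_splits)
    with \<open>p = _\<close> show "p \<in> ?R" by auto
  qed (auto split: if_splits)
  have "inj_on (\<lambda>(a, p). pCons a p) (UNIV \<times> {p :: 'a poly. p = 0 \<or> degree p < m})"
    by (auto simp: inj_on_def)
  with Suc show ?case
    unfolding eq by (auto simp: card_image card_cartesian_product)
qed

text \<open>
  Multiplication by \<open>g\<close> permutes the nonzero residues modulo \<open>f\<close>. Comparing the product of
  all residues before and after gives the claim, as in the classical proof of Fermat's theorem.
\<close>
lemma irreducible_dvd_power_minus_1:
  fixes f g :: "'a::{field,finite} poly"
  assumes f: "irreducible f" and g: "\<not> f dvd g"
  shows "f dvd g ^ (card (UNIV :: 'a set) ^ degree f - 1) - 1"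
proof -
  have prime: "prime_elem f" using f by (rule field_poly_irreducible_imp_prime)
  have f0: "f \<noteq> 0" "degree f > 0"
    using f is_unit_iff_degree[of f] by (auto simp: irreducible_def)
  define R where "R = {p :: 'a poly. p \<noteq> 0 \<and> degree p < degree f}"
  have R_eq: "R = {p. p = 0 \<or> degree p < degree f} - {0}" by (auto simp: R_def)
  have finR: "finite R" and cardR: "card R = card (UNIV :: 'a set) ^ degree f - 1"
    using card_polys_degree_less[where 'a = 'a and m = "degree f"]
    by (auto simp: R_eq card_Diff_singleton)
  have ndvd: "\<not> f dvd p" if "p \<in> R" for p
    using that by (auto simp: R_def dest: dvd_imp_degree_le)
  have maps: "g * p mod f \<in> R" if "p \<in> R" for p
  proof -
    have "\<not> f dvd g * p" using prime g ndvd[OF that] prime_elem_dvd_multD by blast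
    thus ?thesis using f0 degree_mod_less[of f "g * p"] by (auto simp: R_def dvd_eq_mod_eq_0)
  qed
  have "inj_on (\<lambda>p. g * p mod f) R"
  proof (rule inj_onI)
    fix p p' assume p: "p \<in> R" "p' \<in> R" "g * p mod f = g * p' mod f"
    hence "f dvd g * (p - p')" by (simp add: mod_eq_dvd_iff algebra_simps)
    hence "f dvd p - p'" using prime g prime_elem_dvd_multD by blast
    moreover have "degree (p - p') < degree f"
      using p by (auto simp: R_def intro: degree_diff_less)
    ultimately show "p = p'" using dvd_imp_degree_le[of f "p - p'"] by fastforce
  qed
  with maps have bij: "bij_betw (\<lambda>p. g * p mod f) R R"
    using finR by (simp add: bij_betw_def endo_inj_surj image_subset_iff)
  define Q where "Q = \<Prod>R"
  have "[(\<Prod>p\<in>R. g * p mod f) = (\<Prod>p\<in>R. g * p)] (mod f)"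
    by (rule cong_prod) simp
  also have "(\<Prod>p\<in>R. g * p mod f) = Q"
    unfolding Q_def using bij by (rule prod.reindex_bij_betw)
  also have "(\<Prod>p\<in>R. g * p) = g ^ card R * Q"
    by (simp add: prod.distrib Q_def)
  finally have "f dvd g ^ card R * Q - Q"
    by (metis cong_def mod_eq_dvd_iff)
  hence "f dvd (g ^ card R - 1) * Q" by (simp add: algebra_simps)
  moreover have "\<not> f dvd Q"
    unfolding Q_def using finR ndvd
  proof (induction R rule: finite_induct)
    case empty
    show ?case using prime by (auto simp: prime_elem_def)
  next
    case (insert p R)
    thus ?case using prime prime_elem_dvd_multD by fastforce
  qed
  ultimately show ?thesis using prime cardR prime_elem_dvd_multD by metis
qed

lemma finite_field_power_card_minus_1:
  fixes x :: "'a::{field,finite}"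
  assumes "x \<noteq> 0"
  shows "x ^ (card (UNIV :: 'a set) - 1) = 1"
proof -
  have "(\<Prod>y\<in>UNIV-{0}. x * y) = (\<Prod>y\<in>UNIV-{0}. y)"
    by (rule prod.reindex_bij_witness[of _ "\<lambda>y. y / x" "\<lambda>y. x * y"]) (use assms in auto)
  thus ?thesis by (simp add: prod.distrib)
qed

lemma of_nat_coprime_card_nonzero:
  assumes "coprime N (card (UNIV :: 'a::{field,finite} set))"
  shows "(of_nat N :: 'a) \<noteq> 0"
proof
  assume "of_nat N = (0::'a)"
  hence "CHAR('a) dvd N" by (simp add: of_nat_eq_0_iff_char_dvd)
  \<comment> \<open>Translation by \<open>1\<close> permutes the field, so adding \<open>1\<close> once for each element gives \<open>0\<close>.\<close>
  moreover have "(\<Sum>x\<in>UNIV. x + 1) = (\<Sum>x\<in>UNIV. x :: 'a)"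
    by (rule sum.reindex_bij_witness[of _ "\<lambda>x. x - 1" "\<lambda>x. x + 1"]) auto
  hence "of_nat (card (UNIV :: 'a set)) = (0 :: 'a)" by (simp add: sum.distrib)
  hence "CHAR('a) dvd card (UNIV :: 'a set)" by (simp add: of_nat_eq_0_iff_char_dvd)
  ultimately have "CHAR('a) dvd 1" using assms by (metis coprime_def)
  thus False by simp
qed

text \<open>
  The exact power of \<open>2\<close> in \<open>q ^ (2 ^ a * u) - 1\<close> is \<open>2 ^ (s + a)\<close>. An odd exponent does not
  change the power of \<open>2\<close>. Squaring raises it by exactly one as soon as it is at least \<open>4\<close>; for
  \<open>s = 1\<close> the first squaring raises it by more, which is why \<open>a = 0\<close> is then required.
\<close>
lemma power_minus_1_two_part:
  fixes q s t :: nat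
  assumes q: "q = 2 ^ s * t + 1" "1 \<le> s" "odd t" and "odd u" and "2 \<le> s \<or> a = 0"
  obtains w where "odd w" "q ^ (2 ^ a * u) = 2 ^ (s + a) * w + 1"
proof -
  have base: "\<exists>v. (odd v \<longleftrightarrow> odd k) \<and> q ^ k = 2 ^ s * v + 1" for k
  proof (induction k)
    case (Suc k)
    then obtain v where v: "odd v \<longleftrightarrow> odd k" "q ^ k = 2 ^ s * v + 1" by blast
    have "q ^ Suc k = 2 ^ s * (v + t + 2 ^ s * (v * t)) + 1"
      by (simp add: v(2)) (simp add: q(1) algebra_simps)
    moreover have "odd (v + t + 2 ^ s * (v * t)) \<longleftrightarrow> odd (Suc k)"
      using v(1) q by auto
    ultimately show ?case by blast
  qed (auto intro: exI[of _ 0])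
  have "\<exists>w. odd w \<and> q ^ (2 ^ a * u) = 2 ^ (s + a) * w + 1"
    using \<open>2 \<le> s \<or> a = 0\<close>
  proof (induction a)
    case 0
    show ?case using base[of u] \<open>odd u\<close> by auto
  next
    case (Suc a)
    then obtain w where w: "odd w" "q ^ (2 ^ a * u) = 2 ^ (s + a) * w + 1" by auto
    obtain e where e: "s + a = Suc (Suc e)"
      using Suc.prems by (metis Suc_leD add_2_eq_Suc le_add1 le_Suc_ex nat.simps(3) add.assoc)
    have "q ^ (2 ^ Suc a * u) = (q ^ (2 ^ a * u))\<^sup>2"
      by (simp flip: power_mult add: mult_ac)
    also have "\<dots> = 2 ^ (s + Suc a) * (w * (1 + 2 ^ Suc e * w)) + 1"
      unfolding w(2) add_Suc_right e by (simp add: power2_eq_square algebra_simps)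
    finally show ?case using w(1) by (intro exI[of _ "w * (1 + 2 ^ Suc e * w)"]) auto
  qed
  thus ?thesis using that by blast
qed

section \<open>Irreducibility of binomials\<close>

text \<open>
  A nonconstant divisor of least degree is irreducible.
\<close>
lemma nonconstant_has_irreducible_divisor:
  fixes p :: "'a::field poly"
  assumes "degree p > 0"
  obtains f where "irreducible f" "f dvd p"
proof -
  obtain f where f: "f dvd p" "degree f > 0"
    and min: "\<And>g. g dvd p \<Longrightarrow> degree g > 0 \<Longrightarrow> degree f \<le> degree g"
    using ex_has_least_nat[of "\<lambda>g. g dvd p \<and> degree g > 0" p degree] assms by auto
  have "irreducible f"
  proof (rule irreducibleI)
    show "f \<noteq> 0" using f by auto
    thus "\<not> is_unit f" using f by (simp add: is_unit_iff_degree)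
    fix a b assume ab: "f = a * b"
    hence nz: "a \<noteq> 0" "b \<noteq> 0" using \<open>f \<noteq> 0\<close> by auto
    have "degree f = degree a + degree b" using nz ab by (simp add: degree_mult_eq)
    moreover have "a dvd p" using f(1) ab dvd_trans by auto
    ultimately have "degree a = 0 \<or> degree b = 0" using min[of a] by linarith
    thus "is_unit a \<or> is_unit b" using nz by (simp add: is_unit_iff_degree)
  qed
  thus ?thesis using f(1) that by blast
qed

lemma irreducible_if_irreducible_divisors_large:
  fixes p :: "'a::field poly"
  assumes "degree p > 0" "\<And>f. irreducible f \<Longrightarrow> f dvd p \<Longrightarrow> degree p \<le> degree f"
  shows "irreducible p"
proof -
  obtain f where f: "irreducible f" "f dvd p"
    using nonconstant_has_irreducible_divisor assms(1) by blast
  then obtain c where c: "p = f * c" by (auto elim: dvdE)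
  have nz: "f \<noteq> 0" "c \<noteq> 0" using assms(1) c by auto
  have "degree c = 0" using assms(2)[OF f] nz unfolding c by (simp add: degree_mult_eq)
  hence "is_unit c" using nz by (simp add: is_unit_iff_degree)
  thus ?thesis using f(1) irreducible_mult_unit_left[of c f] c by (simp add: mult.commute)
qed

text \<open>
  By Euler's criterion the hypothesis on \<open>\<beta>\<close> says that it is a nonsquare. An irreducible divisor
  \<open>f\<close> whose degree is less than \<open>2 ^ r\<close> has a degree in which the exponent \<open>a\<close> of \<open>2\<close> is less
  than \<open>r\<close>. Then \<open>q ^ degree f - 1 = 2 ^ (s + a) * w\<close> with \<open>w\<close> odd divides
  \<open>2 ^ r * (2 ^ (s - 1) * w)\<close>, so that \<open>\<beta> ^ (2 ^ (s - 1) * w) = 1\<close>; raising to the power \<open>t\<close>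
  gives \<open>(-1) ^ w = 1\<close>.
\<close>
lemma irreducible_binomial_power_2:
  fixes \<beta> :: "'a::{field,finite}"
  assumes q: "card (UNIV :: 'a set) = 2 ^ s * t + 1" "1 \<le> s" "odd t"
    and b: "\<beta> ^ (2 ^ (s - 1) * t) = -1" and sr: "2 \<le> s \<or> r \<le> 1"
    and two: "(2 :: 'a) \<noteq> 0"
  shows "irreducible (monom 1 (2 ^ r) - [:\<beta>:])"
proof (rule irreducible_if_irreducible_divisors_large)
  let ?P = "monom 1 (2 ^ r) - [:\<beta>:]"
  let ?q = "card (UNIV :: 'a set)"
  have b0: "\<beta> \<noteq> 0"
  proof
    assume "\<beta> = 0"
    moreover have "2 ^ (s - 1) * t \<noteq> 0" using q(3) by (cases t) auto
    ultimately show False using b by (simp add: power_0_left)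
  qed
  have deg: "degree ?P = 2 ^ r"
    using degree_add_eq_left[of "[:- \<beta>:]" "monom 1 (2 ^ r)"]
    by (simp add: degree_monom_eq diff_conv_add_uminus del: add_uminus_conv_diff)
  thus "degree ?P > 0" by simp
  fix f assume f: "irreducible f" "f dvd ?P"
  define X where "X = (monom 1 1 :: 'a poly)"
  have mon: "monom 1 k = X ^ k" for k by (simp add: X_def monom_altdef)
  have not_dvd_const: "\<not> f dvd [:c:]" if "c \<noteq> 0" for c
    using f(1) that by (metis dvd_trans irreducible_not_unit is_unit_triv)
  have "f \<noteq> 0" "\<not> is_unit f" using f(1) by (auto simp: irreducible_def)
  hence m0: "degree f > 0" using is_unit_iff_degree by blast
  show "degree ?P \<le> degree f"
  proof (rule ccontr)
    assume "\<not> ?thesis"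
    hence less: "degree f < 2 ^ r" using deg by simp
    obtain a u where u: "odd u" "degree f = 2 ^ a * u"
      using multiplicity_decompose'[of "degree f" 2] m0 that
      by (metis bot_nat_0.not_eq_extremum odd_one)
    have "2 ^ a \<le> degree f" using u m0 by (cases u) auto
    with less have "(2::nat) ^ a < 2 ^ r" by linarith
    hence ar: "a < r" by simp
    obtain w where w: "odd w" "?q ^ degree f = 2 ^ (s + a) * w + 1"
      using power_minus_1_two_part[OF q u(1), of a] sr ar u(2)
      by (metis le_neq_implies_less less_one less_le_trans)
    have "\<not> f dvd X"
    proof
      assume "f dvd X"
      hence "f dvd X ^ 2 ^ r" by (simp add: dvd_power_le dvd_trans[OF _ dvd_power])
      with f(2) have "f dvd X ^ 2 ^ r - ?P" by (rule dvd_diff[rotated])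
      thus False using not_dvd_const[OF b0] by (simp add: mon)
    qed
    hence "f dvd X ^ (2 ^ (s + a) * w) - 1"
      using irreducible_dvd_power_minus_1[OF f(1), of X] w(2) by simp
    hence "[X ^ (2 ^ (s + a) * w) = 1] (mod f)" by (simp add: cong_def mod_eq_dvd_iff)
    \<comment> \<open>The exponent is chosen so that the left-hand side becomes a power of \<open>X ^ 2 ^ r\<close>.\<close>
    hence "[(X ^ (2 ^ (s + a) * w)) ^ (2 ^ (r - 1 - a)) = 1 ^ (2 ^ (r - 1 - a))] (mod f)"
      by (rule cong_pow)
    moreover have "(X ^ (2 ^ (s + a) * w)) ^ (2 ^ (r - 1 - a)) = (X ^ 2 ^ r) ^ (2 ^ (s - 1) * w)"
    proof -
      have "2 ^ (s + a) * w * 2 ^ (r - 1 - a) = 2 ^ (s + a + (r - 1 - a)) * w"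
        unfolding power_add by (simp add: mult_ac)
      also have "s + a + (r - 1 - a) = r + (s - 1)" using ar q(2) by simp
      also have "2 ^ (r + (s - 1)) * w = 2 ^ r * (2 ^ (s - 1) * w)"
        by (simp only: power_add mult.assoc)
      finally show ?thesis by (simp only: power_mult[symmetric])
    qed
    moreover have "[X ^ 2 ^ r = [:\<beta>:]] (mod f)"
      using f(2) by (simp add: cong_def mod_eq_dvd_iff mon)
    ultimately have "[[:\<beta>:] ^ (2 ^ (s - 1) * w) = 1] (mod f)"
      by (metis cong_pow cong_sym cong_trans power_one)
    hence "f dvd [:\<beta> ^ (2 ^ (s - 1) * w) - 1:]"
      by (simp add: cong_def mod_eq_dvd_iff poly_const_pow one_pCons)
    hence "\<beta> ^ (2 ^ (s - 1) * w) - 1 = 0" using not_dvd_const by blast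
    hence pow_w: "\<beta> ^ (2 ^ (s - 1) * w) = 1" by (simp only: right_minus_eq)
    have "(-1 :: 'a) = (\<beta> ^ (2 ^ (s - 1) * t)) ^ w" unfolding b using w(1) by simp
    also have "\<dots> = (\<beta> ^ (2 ^ (s - 1) * w)) ^ t" by (simp only: power_mult[symmetric] mult_ac)
    also have "\<dots> = 1" unfolding pow_w by simp
    finally have "(1 :: 'a) + 1 = 0" by (metis add.right_inverse)
    thus False using two by simp
  qed
qed

section \<open>Squarefreeness and counting\<close>

text \<open>
  A double factor would divide the derivative \<open>N * x ^ (N - 1)\<close> as well, hence both \<open>x ^ N\<close> and
  \<open>x ^ N - 1\<close>.
\<close>
lemma square_not_dvd_power_minus_1:
  fixes p :: "'a::field poly"
  assumes N: "(of_nat N :: 'a) \<noteq> 0" and "\<not> is_unit p"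
  shows "\<not> p * p dvd monom 1 N - 1"
proof
  assume "p * p dvd monom 1 N - 1"
  then obtain c where c: "monom 1 N - 1 = p * (p * c)" unfolding dvd_def by (auto simp: mult.assoc)
  have "N > 0" using N by (cases N) auto
  have "pderiv (monom 1 N - 1 :: 'a poly) = monom (of_nat N) (N - 1)"
    by (simp add: pderiv_diff pderiv_monom)
  also have "pderiv (monom 1 N - 1 :: 'a poly) = p * (p * pderiv c + 2 * c * pderiv p)"
    unfolding c by (simp add: pderiv_mult algebra_simps)
  finally have "p dvd monom (of_nat N) (N - 1)" by (metis dvd_triv_left)
  hence "p dvd monom (of_nat N) (N - 1) * monom (inverse (of_nat N)) 1" by (rule dvd_mult2)
  hence "p dvd monom 1 N" using N \<open>N > 0\<close> by (simp add: mult_monom)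
  moreover have "p dvd monom 1 N - 1" unfolding c by simp
  ultimately have "p dvd monom 1 N - (monom 1 N - 1)" by (rule dvd_diff)
  thus False using \<open>\<not> is_unit p\<close> by simp
qed

lemma size_eq_card_if_squarefree_prod:
  assumes "\<And>p. p \<in># M \<Longrightarrow> \<not> p * p dvd prod_mset M"
  shows "card (set_mset M) = size M"
proof -
  have "count M p = 1" if "p \<in># M" for p
  proof (rule ccontr)
    assume "count M p \<noteq> 1"
    with that have "{#p, p#} \<subseteq># M"
      by (simp add: subseteq_mset_def)
        (metis One_nat_def Suc_leI count_greater_zero_iff le_neq_implies_less numeral_2_eq_2)
    from prod_mset_subset_imp_dvd[OF this] assms[OF that] show False by simp
  qed
  thus ?thesis by (simp add: size_multiset_overloaded_eq)
qed

section \<open>Reducible binomials\<close>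

text \<open>
  For odd \<open>m\<close> the exponent \<open>3 * m\<^sup>2 + 1\<close> is divisible by \<open>4\<close>, and \<open>u\<close> raised to it is
  \<open>u\<close> itself.
\<close>
lemma odd_order_is_fourth_power:
  fixes u :: "'a::monoid_mult"
  assumes "u ^ m = 1" "odd m"
  obtains b where "u = b ^ 4"
proof -
  have "4 dvd 3 * m * m + 1"
  proof -
    obtain k where "m = 2 * k + 1" using \<open>odd m\<close> by (elim oddE)
    hence "3 * m * m + 1 = 4 * (3 * k * k + 3 * k + 1)" by (simp add: algebra_simps)
    thus ?thesis by simp
  qed
  then obtain e where e: "3 * m * m + 1 = e * 4" by (metis dvd_def mult.commute)
  have "u = (u ^ m) ^ (3 * m) * u" using assms by simp
  also have "\<dots> = u ^ (3 * m * m + 1)" by (simp add: mult_ac flip: power_mult power_Suc2)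
  also have "\<dots> = (u ^ e) ^ 4" unfolding e by (rule power_mult)
  finally show ?thesis using that by blast
qed

text \<open>
  With \<open>y = x ^ 2 ^ (r - 2)\<close>, the identity
  \<open>y ^ 4 + 4 * b ^ 4 = (y\<^sup>2 + 2 * b * y + 2 * b\<^sup>2) * (y\<^sup>2 - 2 * b * y + 2 * b\<^sup>2)\<close> is a proper
  factorization.
\<close>
lemma sophie_germain_reducible:
  fixes b :: "'a::field"
  assumes "r \<ge> 2"
  shows "\<not> irreducible (monom 1 (2 ^ r) + [:4 * b ^ 4:])"
proof
  define Y where "Y = (monom 1 (2 ^ (r - 2)) :: 'a poly)"
  define A where "A = Y\<^sup>2 + ([:2 * b:] * Y + [:2 * b\<^sup>2:])"
  define B where "B = Y\<^sup>2 + ([:- 2 * b:] * Y + [:2 * b\<^sup>2:])"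
  have "(2::nat) ^ r = 2 ^ (r - 2) * 4"
    using assms by (metis le_add_diff_inverse2 power_add power2_eq_square numeral_Bit0 mult_2)
  hence "monom 1 (2 ^ r) = Y ^ 4" by (simp add: Y_def monom_power)
  moreover have "[:4 * b ^ 4:] = [:4:] * [:b:] ^ 4" "[:2 * b:] = 2 * [:b:]" "[:- 2 * b:] = - 2 * [:b:]"
     "[:2 * b\<^sup>2:] = 2 * [:b:]\<^sup>2" "[:4:] = (4 :: 'a poly)"
    by (simp_all add: poly_const_pow numeral_poly)
  ultimately have AB: "monom 1 (2 ^ r) + [:4 * b ^ 4:] = A * B"
    unfolding A_def B_def by (simp only:) (simp add: algebra_simps power2_eq_square power4_eq_xxxx)
  have degY: "degree (Y\<^sup>2) = 2 * 2 ^ (r - 2)" "degree Y = 2 ^ (r - 2)"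
    by (simp_all add: Y_def monom_power degree_monom_eq)
  have low: "degree ([:c:] * Y + [:e:]) < degree (Y\<^sup>2)" for c e :: 'a
  proof -
    have "degree ([:c:] * Y + [:e:]) \<le> degree Y"
      by (intro degree_add_le) (auto intro: degree_smult_le)
    also have "\<dots> < degree (Y\<^sup>2)" unfolding degY by simp
    finally show ?thesis .
  qed
  have "degree A > 0" "degree B > 0"
    unfolding A_def B_def using low degY by (simp_all only: degree_add_eq_left) simp_all
  hence "\<not> is_unit A" "\<not> is_unit B"
    by (metis degree_0 is_unit_iff_degree less_irrefl)+
  moreover assume "irreducible (monom 1 (2 ^ r) + [:4 * b ^ 4:])"
  ultimately show False unfolding AB by (auto dest: irreducibleD[OF _ refl])
qed

section \<open>The factorization over a finite field\<close>

lemma mem_binomial_factors: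
  assumes "d > 0"
  shows "f \<in># binomial_factors s d n \<alpha> \<gamma> \<longleftrightarrow>
     (\<exists>j<d. f = [:- (\<gamma> ^ j), 1:]
       \<or> (\<exists>k\<in>{1..s}. \<exists>i\<in>{1..2^(k-1)}. f = [:- (\<alpha> (2^k) ^ (2*i-1) * \<gamma> ^ j), 1:])
       \<or> (\<exists>r\<in>{1..n-s}. \<exists>i\<in>{1..2^(s-1)}. f = monom 1 (2^r) - [:\<alpha> (2^s) ^ (2*i-1) * \<gamma> ^ j:]))"
proof -
  have "{0..d-1} = {..<d}" using assms by auto
  thus ?thesis by (simp add: binomial_factors_def set_mset_sum Bex_def)
qed

lemma size_binomial_factors:
  assumes "1 \<le> s" "d > 0"
  shows "size (binomial_factors s d n \<alpha> \<gamma>) = 2 ^ (s - 1) * (n - s + 2) * d"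
proof -
  have "(\<Sum>k=1..s. 2 ^ (k - 1) :: nat) = (\<Sum>k<s. 2 ^ k)"
    by (rule sum.reindex_bij_witness[of _ Suc "\<lambda>k. k - 1"]) auto
  also have "\<dots> + 1 = 2 ^ s"
    by (induction s) auto
  finally have "1 + ((\<Sum>k=1..s. 2 ^ (k - 1)) + (n - s) * 2 ^ (s - 1)) = 2 ^ (s - 1) * (n - s + 2)"
    using assms(1) by (cases s) (simp_all add: algebra_simps)
  moreover have "size (binomial_factors s d n \<alpha> \<gamma>) =
      (1 + ((\<Sum>k=1..s. 2 ^ (k - 1)) + (n - s) * 2 ^ (s - 1))) * d"
    using assms(2) by (simp add: binomial_factors_def mult.commute)
  ultimately show ?thesis by (simp only:)
qed

theorem theorem3p2:
  fixes q s t d n :: nat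
    and \<gamma> :: "'a::{field,finite}"
    and \<alpha> :: "nat \<Rightarrow> 'a"
  assumes "card (UNIV :: 'a set) = q"
    and "primepow q" and "odd q"
    and "q = 2 ^ s * t + 1" and "s \<ge> 1" and "odd t"
    and "d > 0" and "odd d"
    and "[q = 1] (mod 2 * d)"
    and "primitive_root_of_unity d \<gamma>"
    and "\<And>k. k \<le> s \<Longrightarrow> primitive_root_of_unity (2 ^ k) (\<alpha> (2 ^ k))"
    and "n \<ge> 1"
  shows
    "(n \<le> s \<longrightarrow>
        monom 1 (2 ^ n * d) - 1 =
        (\<Prod>j=0..d-1.
           [:- (\<gamma> ^ j), 1:]
           * (\<Prod>k=1..n. \<Prod>i=1..2^(k-1). [:- (\<alpha> (2^k) ^ (2*i-1) * \<gamma> ^ j), 1:])))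
   \<and> (n > s \<longrightarrow>
        monom 1 (2 ^ n * d) - 1 =
        (\<Prod>j=0..d-1.
           [:- (\<gamma> ^ j), 1:]
           * (\<Prod>k=1..s. \<Prod>i=1..2^(k-1). [:- (\<alpha> (2^k) ^ (2*i-1) * \<gamma> ^ j), 1:])
           * (\<Prod>r=1..n-s. \<Prod>i=1..2^(s-1).
                (monom 1 (2^r) - [:\<alpha> (2^s) ^ (2*i-1) * \<gamma> ^ j:]))))
   \<and> (n > s \<and> s \<ge> 2 \<longrightarrow>
        (\<forall>f \<in># binomial_factors s d n \<alpha> \<gamma>. irreducible f)
        \<and> size (binomial_factors s d n \<alpha> \<gamma>) = 2 ^ (s - 1) * (n - s + 2) * d
        \<and> card (set_mset (binomial_factors s d n \<alpha> \<gamma>)) = 2 ^ (s - 1) * (n - s + 2) * d)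
   \<and> (n > s \<and> [q = 3] (mod 4) \<longrightarrow>
        (\<forall>f \<in># binomial_factors s d n \<alpha> \<gamma>.
           degree f > 1 \<and> f \<notin> {monom 1 2 + [:\<gamma> ^ j:] | j. j \<le> d - 1} \<longrightarrow> \<not> irreducible f)
        \<and> (\<forall>j \<le> d - 1.
           monom 1 2 + [:\<gamma> ^ j:] \<in># binomial_factors s d n \<alpha> \<gamma>
           \<and> irreducible (monom 1 2 + [:\<gamma> ^ j:])))"
proof -
  note q = assms(4) and s = assms(5) and t = assms(6) and d = assms(7,8)
    and g = assms(10) and a = assms(11)
  let ?M = "binomial_factors s d n \<alpha> \<gamma>"
  have idx: "{0..d-1} = {..<d}" using d by auto
  have card_q: "card (UNIV :: 'a set) = 2 ^ s * t + 1" using assms(1) q by simp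
  have two: "(2 :: 'a) \<noteq> 0"
    using of_nat_coprime_card_nonzero[of 2, where 'a = 'a] assms(1,3) by simp
  have "2 * d dvd 2 ^ s * t"
    using assms(9) q by (simp add: cong_altdef_nat)
  hence "d dvd 2 ^ s * t" by (rule dvd_mult_right)
  hence dt: "d dvd t" using d by (simp add: coprime_dvd_mult_right_iff)
  hence gt: "\<gamma> ^ t = 1" using primitive_root_power_eq_1_iff[OF g] by simp
  have a_half: "\<alpha> (2 ^ s) ^ 2 ^ (s - 1) = -1"
  proof (rule primitive_root_half_power)
    show "primitive_root_of_unity (2 * 2 ^ (s - 1)) (\<alpha> (2 ^ s))"
      using a[of s] s by (simp flip: power_Suc)
  qed
  \<comment> \<open>\<open>r \<le> 1\<close> serves the quadratic factors in the case \<open>s = 1\<close>.\<close>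
  have binom: "irreducible (monom 1 (2 ^ r) - [:\<alpha> (2^s) ^ (2*i-1) * \<gamma> ^ j:])"
    if "2 \<le> s \<or> r \<le> 1" "1 \<le> i" for r i j
  proof (rule irreducible_binomial_power_2[OF card_q s t _ that(1) two])
    have "(\<alpha> (2^s) ^ (2*i-1) * \<gamma> ^ j) ^ (2 ^ (s - 1) * t)
        = (\<alpha> (2 ^ s) ^ 2 ^ (s - 1)) ^ ((2 * i - 1) * t) * (\<gamma> ^ t) ^ (j * 2 ^ (s - 1))"
      by (simp add: power_mult_distrib mult_ac flip: power_mult)
    also have "\<dots> = (-1) ^ ((2 * i - 1) * t)"
      unfolding a_half gt by simp
    also have "odd ((2 * i - 1) * t)" using that(2) t by simp
    hence "(-1) ^ ((2 * i - 1) * t) = (-1 :: 'a)" by simp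
    finally show "(\<alpha> (2^s) ^ (2*i-1) * \<gamma> ^ j) ^ (2 ^ (s - 1) * t) = -1" .
  qed
  have fact1: "n \<le> s \<Longrightarrow> monom 1 (2 ^ n * d) - 1 =
        (\<Prod>j=0..d-1.
           [:- (\<gamma> ^ j), 1:]
           * (\<Prod>k=1..n. \<Prod>i=1..2^(k-1). [:- (\<alpha> (2^k) ^ (2*i-1) * \<gamma> ^ j), 1:]))"
    using power_minus_1_factorization(1)[OF g d(2), of n \<alpha>] a unfolding idx by (simp only: le_trans)
  have fact2: "monom 1 (2 ^ n * d) - 1 =
        (\<Prod>j=0..d-1.
           [:- (\<gamma> ^ j), 1:]
           * (\<Prod>k=1..s. \<Prod>i=1..2^(k-1). [:- (\<alpha> (2^k) ^ (2*i-1) * \<gamma> ^ j), 1:])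
           * (\<Prod>r=1..n-s. \<Prod>i=1..2^(s-1).
                (monom 1 (2^r) - [:\<alpha> (2^s) ^ (2*i-1) * \<gamma> ^ j:])))" if "n > s"
    using power_minus_1_factorization(2)[OF g d(2), of s \<alpha> n] a s that unfolding idx by simp
  have prodM: "prod_mset ?M = monom 1 (2 ^ n * d) - 1" if "n > s"
    unfolding prod_mset_binomial_factors using fact2[OF that] by (rule sym)
  show ?thesis
  proof (intro conjI impI)
    assume ns: "n > s \<and> s \<ge> 2"
    show irr: "\<forall>f \<in># ?M. irreducible f"
      using ns binom by (auto simp: mem_binomial_factors[OF d(1)] intro!: irreducible_linear_field_poly)
    show size: "size ?M = 2 ^ (s - 1) * (n - s + 2) * d"
      using s d by (simp add: size_binomial_factors)
    \<comment> \<open>Distinctness: \<open>2 ^ n * d\<close> is invertible in the field, so the product is squarefree.\<close>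
    have "coprime (2 ^ s * t) q" unfolding q by simp
    moreover have "d dvd 2 ^ s * t" using dt by simp
    ultimately have "coprime d q" using coprime_divisors dvd_refl by blast
    hence "coprime (2 ^ n * d) (card (UNIV :: 'a set))"
      using assms(1,3) by simp
    hence N: "of_nat (2 ^ n * d) \<noteq> (0 :: 'a)" by (rule of_nat_coprime_card_nonzero)
    have "card (set_mset ?M) = size ?M"
    proof (rule size_eq_card_if_squarefree_prod)
      fix p assume "p \<in># ?M"
      hence "\<not> is_unit p" using irr by (auto simp: irreducible_def)
      thus "\<not> p * p dvd prod_mset ?M"
        using square_not_dvd_power_minus_1[OF N] prodM ns by simp
    qed
    thus "card (set_mset ?M) = 2 ^ (s - 1) * (n - s + 2) * d" using size by simp
  next
    assume ns: "n > s \<and> [q = 3] (mod 4)"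
    have "s = 1"
    proof (rule ccontr)
      assume "s \<noteq> 1"
      then obtain e where "s = e + 2" using s
        by (metis add.commute le_Suc_ex le_neq_implies_less Suc_leI Suc_1)
      hence "q mod 4 = 1" using q by (simp add: power_add mod_simps mult.assoc mod_mult_self2)
      thus False using ns by (simp add: cong_def)
    qed
    hence a1: "\<alpha> 2 = -1" using a_half by simp
    have binom_eq: "monom 1 (2 ^ r) - [:\<alpha> (2^s) ^ (2*i-1) * \<gamma> ^ j:] = monom 1 (2 ^ r) + [:\<gamma> ^ j:]"
      if "i \<in> {1..2^(s-1)}" for r i j
      using that by (simp add: \<open>s = 1\<close> a1)
    have red: "\<not> irreducible (monom 1 (2 ^ r) + [:\<gamma> ^ j:])" if "r \<ge> 2" for r j
    proof -
      have four: "(4 :: 'a) \<noteq> 0"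
        using two by (metis mult_2 mult_eq_0_iff numeral_Bit0 one_add_one mult_numeral_1)
      \<comment> \<open>For \<open>s = 1\<close>, \<open>t\<close> is half the order of the multiplicative group, so
        squares such as \<open>4\<close> have odd order.\<close>
      have "(4 :: 'a) ^ t = 2 ^ (card (UNIV :: 'a set) - 1)"
        using \<open>s = 1\<close> card_q by (simp add: power_mult)
      hence "(4 :: 'a) ^ t = 1" using finite_field_power_card_minus_1[OF two] by simp
      hence "(\<gamma> ^ j / 4) ^ t = 1"
        using gt by (simp add: power_divide) (metis mult.commute power_mult power_one)
      then obtain b where "\<gamma> ^ j / 4 = b ^ 4" using t by (rule odd_order_is_fourth_power)
      hence "\<gamma> ^ j = 4 * b ^ 4" using four by (simp add: field_simps)
      thus ?thesis using sophie_germain_reducible[OF that] by simp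
    qed
    show "\<forall>f \<in># ?M. degree f > 1 \<and> f \<notin> {monom 1 2 + [:\<gamma> ^ j:] | j. j \<le> d - 1} \<longrightarrow> \<not> irreducible f"
    proof (intro ballI impI)
      fix f assume f: "f \<in># ?M"
        and "degree f > 1 \<and> f \<notin> {monom 1 2 + [:\<gamma> ^ j:] | j. j \<le> d - 1}"
      then obtain j r where "j < d" "1 \<le> r" "f = monom 1 (2 ^ r) + [:\<gamma> ^ j:]"
        using binom_eq by (auto simp: mem_binomial_factors[OF d(1)])
      moreover have "r \<noteq> 1" using calculation
          \<open>degree f > 1 \<and> f \<notin> {monom 1 2 + [:\<gamma> ^ j:] | j. j \<le> d - 1}\<close> by fastforce
      ultimately show "\<not> irreducible f" using red by simp
    qed
    show "\<forall>j \<le> d - 1. monom 1 2 + [:\<gamma> ^ j:] \<in># ?M \<and> irreducible (monom 1 2 + [:\<gamma> ^ j:])"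
    proof (intro allI impI)
      fix j assume "j \<le> d - 1"
      hence "j < d" using d by simp
      have "monom 1 2 + [:\<gamma> ^ j:] = monom 1 (2 ^ 1) - [:\<alpha> (2^s) ^ (2*1-1) * \<gamma> ^ j:]"
        by (simp add: \<open>s = 1\<close> a1)
      moreover have "1 \<in> {1..n-s}" "1 \<in> {1..2^(s-1)::nat}" using ns by auto
      ultimately show "monom 1 2 + [:\<gamma> ^ j:] \<in># ?M \<and> irreducible (monom 1 2 + [:\<gamma> ^ j:])"
        using \<open>j < d\<close> binom[of 1 1 j] unfolding mem_binomial_factors[OF d(1)]
        by (metis order_refl)
    qed
  qed (use fact1 fact2 in auto)
qed

end
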